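(* Let $X$ be a locally compact Hausdorff space, $S\subseteq\Gamma(X)$ an inverse subsemigroup and $Z$ a topological space. Let $\eta:Z\to(E(S),\tau_{hco})$ be a continuous function. For $A\subseteq Z$, set $$\psi(A)=\bigcap_{z\in A}\mathrm{dom}(\eta(z)).$$ Then: (i) If $A$ is compact, then $\psi(A)$ is open and $\mathrm{id}_{\psi(A)}\in\overline{S}$, where $\overline{S}$ is the $\tau_{hco}$-closure of $S$. (ii) Let $\mathcal{I}:(K(Z),\tau_V)\to(E(\overline{S}),\tau_{hco})$ be defined by $\mathcal{I}(A)=\mathrm{id}_{\psi(A)}$, where $\tau_V$ is the Vietoris topology. Then $\mathcal{I}$ is a continuous extension of $\eta$ (that is, $\mathcal{I}$ is continuous and $\mathcal{I}(\{z\})=\eta(z)$ for all $z\in Z$).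
   Context: $\Gamma(X)$ is the inverse semigroup of all homeomorphisms $f:\mathrm{dom}(f)\to\mathrm{im}(f)$ between open subsets of $X$, under composition of partial maps: $\mathrm{dom}(f\circ g)=\{x\in\mathrm{dom}(g): g(x)\in\mathrm{dom}(f)\}$. For an inverse subsemigroup $S$, $E(S)$ denotes its set of idempotents (each is $\mathrm{id}_V$, the identity map on some open $V\subseteq X$), with the subspace topology; $\overline{S}$ is again an inverse subsemigroup. For $K\subseteq X$ compact and $V\subseteq X$ open, $\langle K;V\rangle=\{f\in\Gamma(X): K\subseteq\mathrm{dom}(f),\ f(K)\subseteq V\}$ and $\langle K;V\rangle^{-1}=\{f\in\Gamma(X): f^{-1}\in\langle K;V\rangle\}$; $\tau_{ico}$ is the topology on $\Gamma(X)$ generated by all these sets. $CL(X)$ is the set of closed subsets of $X$ (including $\emptyset$) with the Fell topology, whose subbasis consists of $V^-=\{A: A\cap V\neq\emptyset\}$ for $V$ open and $W^+=\{A: A\subseteq W\}$ for $W$ open with $X\setminus W$ compact. Let $\mathsf{D}(f)=X\setminus\mathrm{dom}(f)$ and $\mathsf{I}(f)=X\setminus\mathrm{im}(f)$. The topology $\tau_{hco}$ on $\Gamma(X)$ is generated by $\tau_{ico}$ together with the sets $\mathsf{D}^{-1}(U)$ and $\mathsf{I}^{-1}(U)$ for $U$ Fell-open in $CL(X)$. $K(Z)$ is the collection of all compact subsets of $Z$. The Vietoris topology on $K(Z)$ has as a basis the sets $N(U_1,\dots,U_n)=\{K\in K(Z): K\subseteq U_1\cup\dots\cup U_n,\ K\cap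 U_i\neq\emptyset\ \forall i\le n\}$, with each $U_i$ open in $Z$.
   Formalization: For empty A one has ψ(A)=X and id_X may not lie in the closure of S, so id_ψ(A)∈closure(S) and continuity of I are stated for nonempty compact A; on all of K(Z), with ∅ isolated, continuity is stated when id_X lies in the closure of S. *)

theory Defs
  imports "HOL-Analysis.Analysis"
begin

text \<open>
  A partial map is an element of \<open>'a \<rightharpoonup> 'a\<close>. Its domain and image are \<^const>\<open>dom\<close> and
  \<^const>\<open>ran\<close>, and the composition of partial maps is \<^const>\<open>map_comp\<close>, whose
  domain is \<open>{x \<in> dom g. g(x) \<in> dom f}\<close>.
\<close>

definition pimage :: "('a \<rightharpoonup> 'b) \<Rightarrow> 'a set \<Rightarrow> 'b set" where
  "pimage f K = {y. \<exists>x\<in>K. f x = Some y}"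

text \<open>Meaningful only for injective \<open>f\<close>.\<close>

definition pinv :: "('a \<rightharpoonup> 'b) \<Rightarrow> ('b \<rightharpoonup> 'a)" where
  "pinv f = (\<lambda>y. if y \<in> ran f then Some (THE x. f x = Some y) else None)"

definition pid :: "'a set \<Rightarrow> ('a \<rightharpoonup> 'a)" where
  "pid V = Some |` V"

text \<open>The carrier of the inverse semigroup \<open>\<Gamma>(X)\<close>.\<close>

definition partial_homeos :: "'a topology \<Rightarrow> ('a \<rightharpoonup> 'a) set" where
  "partial_homeos X = {f. openin X (dom f) \<and> openin X (ran f) \<and>
     homeomorphic_map (subtopology X (dom f)) (subtopology X (ran f)) (\<lambda>x. the (f x))}"

definition inverse_subsemigroup :: "'a topology \<Rightarrow> ('a \<rightharpoonup> 'a) set \<Rightarrow> bool" where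
  "inverse_subsemigroup X S \<longleftrightarrow>
     S \<subseteq> partial_homeos X \<and> (\<forall>f\<in>S. \<forall>g\<in>S. f \<circ>\<^sub>m g \<in> S) \<and> (\<forall>f\<in>S. pinv f \<in> S)"

definition idempotents :: "('a \<rightharpoonup> 'a) set \<Rightarrow> ('a \<rightharpoonup> 'a) set" where
  "idempotents S = {e \<in> S. e \<circ>\<^sub>m e = e}"

definition co_set :: "'a topology \<Rightarrow> 'a set \<Rightarrow> 'a set \<Rightarrow> ('a \<rightharpoonup> 'a) set" where
  "co_set X K V = {f \<in> partial_homeos X. K \<subseteq> dom f \<and> pimage f K \<subseteq> V}"

definition co_inv_set :: "'a topology \<Rightarrow> 'a set \<Rightarrow> 'a set \<Rightarrow> ('a \<rightharpoonup> 'a) set" where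
  "co_inv_set X K V = {f \<in> partial_homeos X. pinv f \<in> co_set X K V}"

definition tau_ico :: "'a topology \<Rightarrow> ('a \<rightharpoonup> 'a) topology" where
  "tau_ico X = topology_generated_by
     ({co_set X K V | K V. compactin X K \<and> openin X V} \<union>
      {co_inv_set X K V | K V. compactin X K \<and> openin X V})"

text \<open>The Fell topology on the set \<open>CL(X)\<close> of closed subsets, including the empty one.\<close>

definition fell :: "'a topology \<Rightarrow> 'a set topology" where
  "fell X = topology_generated_by
     ({{A. closedin X A \<and> A \<inter> V \<noteq> {}} | V. openin X V} \<union>
      {{A. closedin X A \<and> A \<subseteq> W} | W. openin X W \<and> compactin X (topspace X - W)})"

definition D_map :: "'a topology \<Rightarrow> ('a \<rightharpoonup> 'a) \<Rightarrow> 'a set" where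
  "D_map X f = topspace X - dom f"

definition I_map :: "'a topology \<Rightarrow> ('a \<rightharpoonup> 'a) \<Rightarrow> 'a set" where
  "I_map X f = topspace X - ran f"

definition tau_hco :: "'a topology \<Rightarrow> ('a \<rightharpoonup> 'a) topology" where
  "tau_hco X = topology_generated_by
     ({\<U>. openin (tau_ico X) \<U>} \<union>
      {{f \<in> partial_homeos X. D_map X f \<in> U} | U. openin (fell X) U} \<union>
      {{f \<in> partial_homeos X. I_map X f \<in> U} | U. openin (fell X) U})"

text \<open>
  The Vietoris topology on the set of all compact subsets. A finite family \<open>U\<^sub>1, \<dots>, U\<^sub>n\<close> is
  given by the finite set \<open>\<U>\<close> of its members. The case \<open>n = 0\<close> is allowed: it yields the
  basic set \<open>{\<emptyset>}\<close>, so that the basic sets cover all compact sets and \<open>\<emptyset>\<close> is an isolated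
  point. On the nonempty compact sets this is the topology generated with \<open>n \<ge> 1\<close>.
\<close>

definition vietoris_basic :: "'z topology \<Rightarrow> 'z set set \<Rightarrow> 'z set set" where
  "vietoris_basic Z \<U> = {K. compactin Z K \<and> K \<subseteq> \<Union>\<U> \<and> (\<forall>U\<in>\<U>. K \<inter> U \<noteq> {})}"

definition vietoris :: "'z topology \<Rightarrow> 'z set topology" where
  "vietoris Z = topology_generated_by
     {vietoris_basic Z \<U> | \<U>. finite \<U> \<and> (\<forall>U\<in>\<U>. openin Z U)}"

text \<open>The intersection is taken inside \<open>X\<close>, so \<open>\<psi>(\<emptyset>) = X\<close>.\<close>

definition psi :: "'a topology \<Rightarrow> ('z \<Rightarrow> ('a \<rightharpoonup> 'a)) \<Rightarrow> 'z set \<Rightarrow> 'a set" where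
  "psi X \<eta> A = topspace X \<inter> (\<Inter>z\<in>A. dom (\<eta> z))"

definition I_ext :: "'a topology \<Rightarrow> ('z \<Rightarrow> ('a \<rightharpoonup> 'a)) \<Rightarrow> 'z set \<Rightarrow> ('a \<rightharpoonup> 'a)" where
  "I_ext X \<eta> A = pid (psi X \<eta> A)"

end

theory Submission
  imports Defs
begin

text \<open>
  An idempotent of \<open>\<Gamma>(X)\<close> is the identity on an open set \<open>V\<close>, so it is determined by the closed
  set \<open>X - V\<close>. The whole proof rests on the observation that this identifies the idempotents, with
  the topology \<^const>\<open>tau_hco\<close>, with the closed sets under the Fell topology: the map \<^const>\<open>D_map\<close>
  is continuous into \<^const>\<open>fell\<close> by the very definition of \<^const>\<open>tau_hco\<close>, and its inverse
  \<open>C \<mapsto> id\<^bsub>X - C\<^esub>\<close> is continuous because \<open>K \<subseteq> V\<close> says the same as \<open>X - V \<subseteq> X - K\<close>,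
  where \<open>X - K\<close> is open for compact \<open>K\<close> since \<open>X\<close> is Hausdorff (lemma \<open>continuous_map_pid_compl\<close>).

  Intersecting the domains of \<open>\<eta> z\<close> for \<open>z \<in> A\<close> means taking the union of the closed sets
  \<open>g z = X - dom (\<eta> z)\<close>. The theorem therefore becomes a statement about a continuous map \<open>g\<close> from
  \<open>Z\<close> to the closed sets. A union of \<open>g\<close> over a compact set is closed since local compactness
  of \<open>X\<close> turns \<open>x \<notin> g z\<close> into a condition that is open in \<open>x\<close> and \<open>z\<close> jointly
  (\<open>closedin_Union_fell_compact\<close>). The union depends continuously on the compact set because missing
  a compact set and hitting an open set are conditions on unions that can be tested member by member
  (\<open>continuous_map_Union_vietoris_fell\<close>). It is the limit of the unions over finite subsets
  (\<open>limitin_Union_fell_finite_subsets\<close>). For a nonempty finite subset, the identity on the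
  complement of the union is a product of finitely many \<open>\<eta> z\<close>, hence lies in \<open>S\<close>.
\<close>

section \<open>Topologies given by a subbasis\<close>

lemma limitin_topology_generated_by:
  assumes "l \<in> \<Union>\<B>"
    and "\<And>B. B \<in> \<B> \<Longrightarrow> l \<in> B \<Longrightarrow> eventually (\<lambda>x. f x \<in> B) F"
  shows "limitin (topology_generated_by \<B>) f l F"
proof -
  have "eventually (\<lambda>x. f x \<in> U) F" if "generate_topology_on \<B> U" "l \<in> U" for U
    using that
  proof (induction)
    case (Int a b)
    then show ?case by (simp add: eventually_conj)
  next
    case (UN K)
    then obtain k where "k \<in> K" "l \<in> k" by blast
    then have "eventually (\<lambda>x. f x \<in> k) F" using UN.IH by blast
    then show ?case by (rule eventually_mono) (use \<open>k \<in> K\<close> in blast)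
  qed (use assms in auto)
  then show ?thesis
    using assms(1) by (auto simp: limitin_def openin_topology_generated_by_iff)
qed

lemma limitin_imp_in_closure_of:
  assumes "limitin X f l F" "eventually (\<lambda>x. f x \<in> S) F" "F \<noteq> bot"
  shows "l \<in> X closure_of S"
  unfolding in_closure_of
proof (intro conjI allI impI)
  show "l \<in> topspace X" using assms(1) by (simp add: limitin_def)
  fix T assume "l \<in> T \<and> openin X T"
  then have "eventually (\<lambda>x. f x \<in> T) F" using assms(1) by (simp add: limitin_def)
  then have "eventually (\<lambda>x. f x \<in> S \<and> f x \<in> T) F"
    using assms(2) by (simp add: eventually_conj)
  then show "\<exists>y. y \<in> S \<and> y \<in> T"
    using eventually_happens'[OF assms(3)] by blast
qed

section \<open>The Fell topology\<close>

lemma topspace_fell [simp]: "topspace (fell X) = {C. closedin X C}"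
proof -
  have "C \<in> topspace (fell X)" if "closedin X C" for C
  proof -
    have "{A. closedin X A \<and> A \<subseteq> topspace X} \<in>
      {{A. closedin X A \<and> A \<subseteq> W} | W. openin X W \<and> compactin X (topspace X - W)}"
      by (rule CollectI, rule exI[of _ "topspace X"]) simp
    then show ?thesis
      using that closedin_subset[OF that] unfolding fell_def topology_generated_by_topspace
      by blast
  qed
  moreover have "closedin X C" if "C \<in> topspace (fell X)" for C
    using that unfolding fell_def by auto
  ultimately show ?thesis by blast
qed

lemma openin_fell_hit: "openin X V \<Longrightarrow> openin (fell X) {C. closedin X C \<and> C \<inter> V \<noteq> {}}"
  unfolding fell_def by (rule topology_generated_by_Basis) blast

lemma openin_fell_miss:
  assumes "Hausdorff_space X" "compactin X K"
  shows "openin (fell X) {C. closedin X C \<and> C \<inter> K = {}}"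
proof -
  have "openin X (topspace X - K)" "compactin X (topspace X - (topspace X - K))"
    using assms by (auto simp: compactin_imp_closedin Diff_Diff_Int inf_absorb2 compactin_subset_topspace)
  then have "openin (fell X) {C. closedin X C \<and> C \<subseteq> topspace X - K}"
    unfolding fell_def by (intro topology_generated_by_Basis) blast
  moreover have "{C. closedin X C \<and> C \<subseteq> topspace X - K} = {C. closedin X C \<and> C \<inter> K = {}}"
    by (auto dest: closedin_subset)
  ultimately show ?thesis by simp
qed

lemma continuous_map_fell_closedin:
  "continuous_map Z (fell X) g \<Longrightarrow> z \<in> topspace Z \<Longrightarrow> closedin X (g z)"
  using continuous_map_image_subset_topspace[of Z "fell X" g] by auto

lemma openin_hit_preimage:
  assumes "continuous_map Z (fell X) g" "openin X V"
  shows "openin Z {z \<in> topspace Z. g z \<inter> V \<noteq> {}}"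
proof -
  have "openin Z {z \<in> topspace Z. g z \<in> {C. closedin X C \<and> C \<inter> V \<noteq> {}}}"
    using assms openin_continuous_map_preimage openin_fell_hit by blast
  moreover have "{z \<in> topspace Z. g z \<in> {C. closedin X C \<and> C \<inter> V \<noteq> {}}}
      = {z \<in> topspace Z. g z \<inter> V \<noteq> {}}"
    using continuous_map_fell_closedin[OF assms(1)] by auto
  ultimately show ?thesis by simp
qed

lemma openin_miss_preimage:
  assumes "continuous_map Z (fell X) g" "Hausdorff_space X" "compactin X K"
  shows "openin Z {z \<in> topspace Z. g z \<inter> K = {}}"
proof -
  have "openin Z {z \<in> topspace Z. g z \<in> {C. closedin X C \<and> C \<inter> K = {}}}"
    using assms openin_continuous_map_preimage openin_fell_miss by blast
  moreover have "{z \<in> topspace Z. g z \<in> {C. closedin X C \<and> C \<inter> K = {}}}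
      = {z \<in> topspace Z. g z \<inter> K = {}}"
    using continuous_map_fell_closedin[OF assms(1)] by auto
  ultimately show ?thesis by simp
qed

section \<open>Idempotents as closed sets\<close>

lemma dom_pid [simp]: "dom (pid V) = V"
  by (auto simp: pid_def)

lemma ran_pid [simp]: "ran (pid V) = V"
  by (auto simp: pid_def ran_def restrict_map_def)

lemma pimage_pid: "pimage (pid V) K = V \<inter> K"
  by (auto simp: pimage_def pid_def restrict_map_def)

lemma pid_comp_pid: "pid U \<circ>\<^sub>m pid V = pid (U \<inter> V)"
  by (rule ext) (simp add: map_comp_def pid_def restrict_map_def)

lemma pinv_pid: "pinv (pid V) = pid V"
proof (rule ext)
  fix y
  have "(THE x. pid V x = Some y) = y" if "y \<in> V"
    by (rule the_equality) (use that in \<open>auto simp: pid_def restrict_map_def split: if_splits\<close>)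
  then show "pinv (pid V) y = pid V y"
    by (auto simp: pinv_def) (auto simp: pid_def)
qed

lemma pid_in_partial_homeos:
  assumes "openin X V"
  shows "pid V \<in> partial_homeos X"
proof -
  have "homeomorphic_map (subtopology X V) (subtopology X V) (\<lambda>x. the (pid V x))"
    by (rule homeomorphic_map_eq[OF homeomorphic_map_id[THEN iffD2, OF refl]])
      (auto simp: pid_def)
  then show ?thesis using assms by (simp add: partial_homeos_def)
qed

text \<open>
  From \<open>e x = y\<close> idempotence gives \<open>e y = y\<close> as well, so injectivity of \<open>e\<close> forces \<open>x = y\<close>.
\<close>

lemma idempotent_eq_pid:
  assumes "e \<in> partial_homeos X" "e \<circ>\<^sub>m e = e"
  shows "e = pid (dom e)"
proof (rule ext)
  fix x
  have "dom e \<subseteq> topspace X" and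
    inj: "inj_on (\<lambda>x. the (e x)) (topspace (subtopology X (dom e)))"
    using assms(1) openin_subset
    by (auto simp: partial_homeos_def homeomorphic_eq_everything_map)
  then have inj: "inj_on (\<lambda>x. the (e x)) (dom e)" by (simp add: Int_absorb1)
  show "e x = pid (dom e) x"
  proof (cases "e x")
    case (Some y)
    then have "e y = Some y" using fun_cong[OF assms(2), of x] by (simp add: map_comp_def)
    then have "x = y" using inj_onD[OF inj, of x y] Some by auto
    then show ?thesis using Some by (simp add: pid_def restrict_map_def domI)
  qed (simp add: pid_def restrict_map_def domIff)
qed

lemma dom_subset_topspace: "f \<in> partial_homeos X \<Longrightarrow> dom f \<subseteq> topspace X"
  by (simp add: partial_homeos_def openin_subset)

lemma topspace_tau_ico: "topspace (tau_ico X) = partial_homeos X"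
proof -
  have "co_set X {} (topspace X) = partial_homeos X"
    by (auto simp: co_set_def pimage_def)
  moreover have "co_set X {} (topspace X) \<in> {co_set X K V | K V. compactin X K \<and> openin X V}"
    by auto
  ultimately have "partial_homeos X \<subseteq> topspace (tau_ico X)"
    unfolding tau_ico_def topology_generated_by_topspace by blast
  moreover have "topspace (tau_ico X) \<subseteq> partial_homeos X"
    unfolding tau_ico_def topology_generated_by_topspace
    by (auto simp: co_set_def co_inv_set_def)
  ultimately show ?thesis by blast
qed

lemma topspace_tau_hco: "topspace (tau_hco X) = partial_homeos X"
proof -
  have "openin (tau_ico X) (partial_homeos X)"
    using openin_topspace[of "tau_ico X"] by (simp add: topspace_tau_ico)
  moreover have "U \<subseteq> partial_homeos X" if "openin (tau_ico X) U" for U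
    using openin_subset[OF that] by (simp add: topspace_tau_ico)
  ultimately show ?thesis
    unfolding tau_hco_def topology_generated_by_topspace by blast
qed

lemma continuous_map_D_map: "continuous_map (tau_hco X) (fell X) (D_map X)"
proof -
  have "openin (tau_hco X) {f \<in> partial_homeos X. D_map X f \<in> U}" if "openin (fell X) U" for U
    unfolding tau_hco_def by (rule topology_generated_by_Basis) (use that in blast)
  moreover have "closedin X (D_map X f)" if "f \<in> partial_homeos X" for f
    using that by (auto simp: D_map_def partial_homeos_def)
  ultimately show ?thesis
    by (auto simp: continuous_map_def topspace_tau_hco)
qed

text \<open>
  The inverse of \<^const>\<open>D_map\<close> on idempotents. For an identity map, the conditions on the inverse
  and on the image repeat those on the map and on the domain. If \<open>K \<subseteq> W\<close>, then membership of
  \<open>id\<^bsub>X - C\<^esub>\<close> in \<^term>\<open>co_set X K W\<close> says that \<open>C\<close> misses \<open>K\<close>; otherwise it is impossible.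
\<close>

lemma continuous_map_pid_compl:
  assumes "Hausdorff_space X"
  shows "continuous_map (fell X) (tau_hco X) (\<lambda>C. pid (topspace X - C))"
proof -
  let ?p = "\<lambda>C. pid (topspace X - C)"
  have ph: "?p C \<in> partial_homeos X" if "closedin X C" for C
    using that by (intro pid_in_partial_homeos) auto
  have co: "openin (fell X) (?p -` co_set X K W \<inter> topspace (fell X))"
    if K: "compactin X K" for K W
  proof (cases "K \<subseteq> W")
    case True
    have "?p -` co_set X K W \<inter> topspace (fell X) = {C. closedin X C \<and> C \<inter> K = {}}"
      using True ph compactin_subset_topspace[OF K] by (auto simp: co_set_def pimage_pid)
    then show ?thesis using openin_fell_miss[OF assms K] by simp
  next
    case False
    then have "?p -` co_set X K W \<inter> topspace (fell X) = {}"
      by (auto simp: co_set_def pimage_pid)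
    then show ?thesis by (simp only: openin_empty)
  qed
  have co_inv: "?p -` co_inv_set X K W = ?p -` co_set X K W" for K W
    by (auto simp: co_inv_set_def co_set_def pinv_pid)
  have ico: "continuous_map (fell X) (tau_ico X) ?p"
    unfolding tau_ico_def
  proof (rule continuous_on_generated_topo)
    show "?p ` topspace (fell X) \<subseteq> \<Union> ({co_set X K V | K V. compactin X K \<and> openin X V} \<union>
      {co_inv_set X K V | K V. compactin X K \<and> openin X V})"
      using ph topspace_tau_ico[of X]
      unfolding tau_ico_def topology_generated_by_topspace by auto
  next
    fix U assume "U \<in> {co_set X K V | K V. compactin X K \<and> openin X V} \<union>
      {co_inv_set X K V | K V. compactin X K \<and> openin X V}"
    then obtain K V where KV: "compactin X K" "U = co_set X K V \<or> U = co_inv_set X K V"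
      by blast
    then have "?p -` U = ?p -` co_set X K V" using co_inv by metis
    then show "openin (fell X) (?p -` U \<inter> topspace (fell X))"
      using co[OF KV(1)] by (simp only:)
  qed
  have compl: "topspace X - (topspace X - C) = C" if "closedin X C" for C
    using closedin_subset[OF that] by blast
  have DI: "?p -` {f \<in> partial_homeos X. D_map X f \<in> U} \<inter> topspace (fell X) = U"
    "?p -` {f \<in> partial_homeos X. I_map X f \<in> U} \<inter> topspace (fell X) = U"
    if "openin (fell X) U" for U
    using openin_subset[OF that] ph by (auto simp: D_map_def I_map_def compl)
  show ?thesis
    unfolding tau_hco_def
  proof (rule continuous_on_generated_topo, goal_cases)
    case (1 U)
    then consider "openin (tau_ico X) U"
      | V where "openin (fell X) V" "U = {f \<in> partial_homeos X. D_map X f \<in> V}"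
      | V where "openin (fell X) V" "U = {f \<in> partial_homeos X. I_map X f \<in> V}"
      by blast
    then show ?case
    proof cases
      case 1
      then show ?thesis
        using openin_continuous_map_preimage[OF ico 1]
        by (simp add: Collect_conj_eq vimage_def Int_commute)
    next
      case (2 V)
      then show ?thesis using DI(1)[OF 2(1)] by (simp only:)
    next
      case (3 V)
      then show ?thesis using DI(2)[OF 3(1)] by (simp only:)
    qed
  next
    case 2
    have "?p ` topspace (fell X) \<subseteq> topspace (tau_hco X)"
      unfolding topspace_tau_hco using ph by auto
    then show ?case unfolding tau_hco_def topology_generated_by_topspace .
  qed
qed

section \<open>Unions of closed sets over a compact set of parameters\<close>

text \<open>
  For \<open>x \<notin> g z\<close> there is a compact neighbourhood \<open>K\<close> of \<open>x\<close> that misses \<open>g z\<close>, and then \<open>K\<close> misses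
  \<open>g z'\<close> for all \<open>z'\<close> near \<open>z\<close>. Finitely many of these neighbourhoods of points \<open>z\<close> cover \<open>A\<close>.
\<close>

lemma closedin_Union_fell_compact:
  assumes X: "locally_compact_space X" "Hausdorff_space X"
    and g: "continuous_map Z (fell X) g" and A: "compactin Z A"
  shows "closedin X (\<Union>z\<in>A. g z)"
proof -
  have AZ: "A \<subseteq> topspace Z" by (rule compactin_subset_topspace[OF A])
  note closed = continuous_map_fell_closedin[OF g]
  have "\<exists>T. openin X T \<and> x \<in> T \<and> T \<subseteq> topspace X - (\<Union>z\<in>A. g z)"
    if x: "x \<in> topspace X" "x \<notin> (\<Union>z\<in>A. g z)" for x
  proof -
    define \<N> where "\<N> = {N. openin Z N \<and> (\<exists>U. openin X U \<and> x \<in> U \<and> (\<forall>z\<in>N. g z \<inter> U = {}))}"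
    have cover: "A \<subseteq> \<Union>\<N>"
    proof
      fix z assume z: "z \<in> A"
      have nb: "neighbourhood_base_of (compactin X) X"
        using X locally_compact_space_neighbourhood_base by blast
      have "openin X (topspace X - g z)" "x \<in> topspace X - g z"
        using closed[of z] x z AZ by auto
      then obtain U K where UK: "openin X U" "compactin X K" "x \<in> U" "U \<subseteq> K"
        "K \<subseteq> topspace X - g z"
        using nb unfolding neighbourhood_base_of by meson
      let ?N = "{z \<in> topspace Z. g z \<inter> K = {}}"
      have "?N \<in> \<N>"
        using openin_miss_preimage[OF g X(2) UK(2)] UK unfolding \<N>_def by blast
      moreover have "z \<in> ?N" using z AZ UK(5) by auto
      ultimately show "z \<in> \<Union>\<N>" by blast
    qed
    obtain \<F> where \<F>: "finite \<F>" "\<F> \<subseteq> \<N>" "A \<subseteq> \<Union>\<F>"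
      using compactinD[OF A, of \<N>] cover unfolding \<N>_def by blast
    then have "\<forall>N\<in>\<F>. \<exists>U. openin X U \<and> x \<in> U \<and> (\<forall>z\<in>N. g z \<inter> U = {})"
      unfolding \<N>_def by blast
    then obtain U where U: "\<And>N. N \<in> \<F> \<Longrightarrow> openin X (U N) \<and> x \<in> U N \<and> (\<forall>z\<in>N. g z \<inter> U N = {})"
      by metis
    \<comment> \<open>Intersecting with the whole space covers the case that \<open>\<F>\<close> is empty.\<close>
    let ?T = "topspace X \<inter> (\<Inter>N\<in>\<F>. U N)"
    have "?T = topspace X \<inter> \<Inter> (insert (topspace X) (U ` \<F>))" by auto
    moreover have "openin X (\<Inter> (insert (topspace X) (U ` \<F>)))"
      by (rule openin_Inter) (use \<F>(1) U in auto)
    ultimately have "openin X ?T" by (metis openin_Int openin_topspace)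
    moreover have "x \<in> ?T" using x U by auto
    moreover have "?T \<subseteq> topspace X - (\<Union>z\<in>A. g z)"
      using \<F>(3) U by blast
    ultimately show ?thesis by blast
  qed
  then have "openin X (topspace X - (\<Union>z\<in>A. g z))"
    by (subst openin_subopen) blast
  moreover have "(\<Union>z\<in>A. g z) \<subseteq> topspace X"
    using closed AZ closedin_subset by blast
  ultimately show ?thesis by (simp add: closedin_def)
qed

lemma openin_vietoris_basic:
  "finite \<U> \<Longrightarrow> (\<And>U. U \<in> \<U> \<Longrightarrow> openin Z U) \<Longrightarrow> openin (vietoris Z) (vietoris_basic Z \<U>)"
  unfolding vietoris_def by (rule topology_generated_by_Basis) blast

text \<open>
  The basic set of the empty family is needed in addition to that of \<open>{U}\<close>, since the latter
  omits the empty set.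
\<close>

lemma openin_vietoris_subset:
  assumes "openin Z U"
  shows "openin (vietoris Z) {A. compactin Z A \<and> A \<subseteq> U}"
proof -
  have "{A. compactin Z A \<and> A \<subseteq> U} = vietoris_basic Z {} \<union> vietoris_basic Z {U}"
    by (auto simp: vietoris_basic_def)
  then show ?thesis using assms by (auto intro: openin_vietoris_basic)
qed

lemma openin_vietoris_hit:
  assumes "openin Z U"
  shows "openin (vietoris Z) {A. compactin Z A \<and> A \<inter> U \<noteq> {}}"
proof -
  have "{A. compactin Z A \<and> A \<inter> U \<noteq> {}} = vietoris_basic Z {topspace Z, U}"
    using compactin_subset_topspace by (fastforce simp: vietoris_basic_def)
  then show ?thesis using assms by (auto intro: openin_vietoris_basic)
qed

lemma topspace_vietoris: "topspace (vietoris Z) = {A. compactin Z A}"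
proof
  show "{A. compactin Z A} \<subseteq> topspace (vietoris Z)"
    using openin_subset[OF openin_vietoris_subset[OF openin_topspace[of Z]]]
      compactin_subset_topspace by blast
  show "topspace (vietoris Z) \<subseteq> {A. compactin Z A}"
    by (auto simp: vietoris_def vietoris_basic_def)
qed

text \<open>
  A union is contained in \<open>W\<close> iff each member is, and meets \<open>V\<close> iff some member does.
  So the preimages of the subbasic Fell sets are given by \<open>A \<subseteq> U\<close> and \<open>A \<inter> U \<noteq> {}\<close>,
  where \<open>U\<close> is the open preimage of the same Fell set under \<open>g\<close>.
\<close>

lemma continuous_map_Union_vietoris_fell:
  assumes X: "locally_compact_space X" "Hausdorff_space X"
    and g: "continuous_map Z (fell X) g"
  shows "continuous_map (vietoris Z) (fell X) (\<lambda>A. \<Union>z\<in>A. g z)"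
proof -
  let ?u = "\<lambda>A. \<Union>z\<in>A. g z"
  note closed = closedin_Union_fell_compact[OF X g]
  have sub: "\<And>A. compactin Z A \<Longrightarrow> A \<subseteq> topspace Z" by (rule compactin_subset_topspace)
  show ?thesis
    unfolding fell_def
  proof (rule continuous_on_generated_topo, goal_cases)
    case (1 \<V>)
    then consider V where "openin X V" "\<V> = {C. closedin X C \<and> C \<inter> V \<noteq> {}}"
      | W where "openin X W" "compactin X (topspace X - W)" "\<V> = {C. closedin X C \<and> C \<subseteq> W}"
      by blast
    then show ?case
    proof cases
      case 1
      have "?u -` \<V> \<inter> topspace (vietoris Z)
        = {A. compactin Z A \<and> A \<inter> {z \<in> topspace Z. g z \<inter> V \<noteq> {}} \<noteq> {}}"
        using closed sub by (fastforce simp: 1 topspace_vietoris)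
      then show ?thesis
        using openin_vietoris_hit[OF openin_hit_preimage[OF g 1(1)]] by simp
    next
      case 2
      have "g z \<subseteq> W \<longleftrightarrow> g z \<inter> (topspace X - W) = {}" if "z \<in> topspace Z" for z
        using closedin_subset[OF continuous_map_fell_closedin[OF g that]] by blast
      then have "?u -` \<V> \<inter> topspace (vietoris Z)
        = {A. compactin Z A \<and> A \<subseteq> {z \<in> topspace Z. g z \<inter> (topspace X - W) = {}}}"
        using closed sub by (fastforce simp: 2 topspace_vietoris)
      then show ?thesis
        using openin_vietoris_subset[OF openin_miss_preimage[OF g X(2) 2(2)]] by simp
    qed
  next
    case 2
    then show ?case
      using closed topspace_fell[of X]
      unfolding fell_def topology_generated_by_topspace topspace_vietoris by auto
  qed
qed

text \<open>
  Passing to a subfamily can only destroy the hitting conditions, and each of them is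
  witnessed by a single index.
\<close>

lemma limitin_Union_fell_finite_subsets:
  assumes "closedin X (\<Union>z\<in>A. g z)" and "\<And>z. z \<in> A \<Longrightarrow> closedin X (g z)"
  shows "limitin (fell X) (\<lambda>F. \<Union>z\<in>F. g z) (\<Union>z\<in>A. g z) (finite_subsets_at_top A)"
  unfolding fell_def
proof (rule limitin_topology_generated_by, goal_cases)
  case 1
  show ?case
    using assms(1) topspace_fell[of X] unfolding fell_def topology_generated_by_topspace by blast
next
  case (2 \<V>)
  have closed: "closedin X (\<Union>z\<in>F. g z)" if "finite F" "F \<subseteq> A" for F
    using that assms(2) by (intro closedin_Union) auto
  from 2(1) consider V where "\<V> = {C. closedin X C \<and> C \<inter> V \<noteq> {}}"
    | W where "\<V> = {C. closedin X C \<and> C \<subseteq> W}"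
    by blast
  then show ?case
  proof cases
    case 1
    then obtain z where z: "z \<in> A" "g z \<inter> V \<noteq> {}" using 2(2) by blast
    have "(\<Union>z\<in>F. g z) \<in> \<V>" if "finite F" "{z} \<subseteq> F" "F \<subseteq> A" for F
      using that z closed 1 by blast
    then show ?thesis
      unfolding eventually_finite_subsets_at_top using z(1) by (intro exI[of _ "{z}"]) simp
  next
    case W: 2
    have "(\<Union>z\<in>F. g z) \<in> \<V>" if "finite F" "F \<subseteq> A" for F
      using that closed W 2(2) by blast
    then show ?thesis by (rule eventually_finite_subsets_at_top_weakI)
  qed
qed

section \<open>Compact intersections of domains of idempotents\<close>

lemma psi_eq_compl_Union: "psi X \<eta> A = topspace X - (\<Union>z\<in>A. D_map X (\<eta> z))"
  by (auto simp: psi_def D_map_def)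

lemma pid_psi_finite_in_subsemigroup:
  assumes S: "inverse_subsemigroup X S"
    and "finite F" "F \<noteq> {}" and "\<And>z. z \<in> F \<Longrightarrow> \<eta> z \<in> idempotents S"
  shows "pid (psi X \<eta> F) \<in> S"
  using assms(2-)
proof (induction F rule: finite_ne_induct)
  case (singleton z)
  then have "\<eta> z \<in> S" "\<eta> z \<in> partial_homeos X" "\<eta> z \<circ>\<^sub>m \<eta> z = \<eta> z"
    using S by (auto simp: idempotents_def inverse_subsemigroup_def)
  then show ?case
    using idempotent_eq_pid[of "\<eta> z" X] dom_subset_topspace[of "\<eta> z" X]
    by (simp add: psi_def inf_absorb2)
next
  case (insert z F)
  then have "\<eta> z \<in> S" "\<eta> z \<in> partial_homeos X" "\<eta> z \<circ>\<^sub>m \<eta> z = \<eta> z"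
    using S by (auto simp: idempotents_def inverse_subsemigroup_def)
  then have "\<eta> z \<circ>\<^sub>m pid (psi X \<eta> F) = pid (psi X \<eta> (insert z F))"
    using idempotent_eq_pid[of "\<eta> z" X] pid_comp_pid[of "dom (\<eta> z)" "psi X \<eta> F"]
    by (simp add: psi_def inf.left_commute)
  moreover have "\<eta> z \<circ>\<^sub>m pid (psi X \<eta> F) \<in> S"
    using S insert \<open>\<eta> z \<in> S\<close> by (simp add: inverse_subsemigroup_def)
  ultimately show ?case by simp
qed

theorem proposition3p16:
  fixes X :: "'a topology" and Z :: "'z topology"
    and S :: "('a \<rightharpoonup> 'a) set" and \<eta> :: "'z \<Rightarrow> ('a \<rightharpoonup> 'a)"
  assumes "locally_compact_space X" and "Hausdorff_space X"
    and "inverse_subsemigroup X S"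
    and "continuous_map Z (subtopology (tau_hco X) (idempotents S)) \<eta>"
  shows "(\<forall>A. compactin Z A \<longrightarrow>
            openin X (psi X \<eta> A) \<and>
            (A \<noteq> {} \<longrightarrow> pid (psi X \<eta> A) \<in> tau_hco X closure_of S)) \<and>
         continuous_map (subtopology (vietoris Z) {A. A \<noteq> {}})
           (subtopology (tau_hco X) (idempotents (tau_hco X closure_of S))) (I_ext X \<eta>) \<and>
         (pid (topspace X) \<in> tau_hco X closure_of S \<longrightarrow>
            continuous_map (vietoris Z)
              (subtopology (tau_hco X) (idempotents (tau_hco X closure_of S))) (I_ext X \<eta>)) \<and>
         (\<forall>z\<in>topspace Z. I_ext X \<eta> {z} = \<eta> z)"
proof -
  let ?g = "\<lambda>z. D_map X (\<eta> z)"
  have \<eta>: "continuous_map Z (tau_hco X) \<eta>" "\<And>z. z \<in> topspace Z \<Longrightarrow> \<eta> z \<in> idempotents S"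
    using assms(4) by (auto simp: continuous_map_in_subtopology)
  have g: "continuous_map Z (fell X) ?g"
    using continuous_map_compose[OF \<eta>(1) continuous_map_D_map] by (simp add: o_def)
  note pc = continuous_map_pid_compl[OF assms(2)]
  have closed: "closedin X (\<Union>z\<in>A. ?g z)" if "compactin Z A" for A
    using closedin_Union_fell_compact[OF assms(1,2) g that] .
  have closure: "pid (psi X \<eta> A) \<in> tau_hco X closure_of S" if A: "compactin Z A" "A \<noteq> {}" for A
  proof (rule limitin_imp_in_closure_of)
    have AZ: "A \<subseteq> topspace Z" by (rule compactin_subset_topspace[OF A(1)])
    have "limitin (fell X) (\<lambda>F. \<Union>z\<in>F. ?g z) (\<Union>z\<in>A. ?g z) (finite_subsets_at_top A)"
      using closed[OF A(1)] continuous_map_fell_closedin[OF g] AZ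
      by (intro limitin_Union_fell_finite_subsets) auto
    from continuous_map_limit[OF pc this]
    show "limitin (tau_hco X) (\<lambda>F. pid (psi X \<eta> F)) (pid (psi X \<eta> A)) (finite_subsets_at_top A)"
      by (simp add: o_def psi_eq_compl_Union)
    obtain a where "a \<in> A" using A(2) by blast
    \<comment> \<open>The finite subsets have to be nonempty, as \<open>S\<close> need not contain the empty product.\<close>
    have "pid (psi X \<eta> F) \<in> S" if "finite F" "{a} \<subseteq> F" "F \<subseteq> A" for F
      using that AZ \<eta>(2) by (intro pid_psi_finite_in_subsemigroup[OF assms(3)]) auto
    then show "eventually (\<lambda>F. pid (psi X \<eta> F) \<in> S) (finite_subsets_at_top A)"
      unfolding eventually_finite_subsets_at_top using \<open>a \<in> A\<close>
      by (intro exI[of _ "{a}"]) simp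
  qed simp
  have cont: "continuous_map (vietoris Z) (tau_hco X) (I_ext X \<eta>)"
    using continuous_map_compose[OF continuous_map_Union_vietoris_fell[OF assms(1,2) g] pc]
    by (simp add: o_def I_ext_def[abs_def] psi_eq_compl_Union)
  have idem: "I_ext X \<eta> A \<in> idempotents (tau_hco X closure_of S)"
    if "pid (psi X \<eta> A) \<in> tau_hco X closure_of S" for A
    using that by (simp add: I_ext_def idempotents_def pid_comp_pid)
  have "openin X (psi X \<eta> A)" if "compactin Z A" for A
    using closed[OF that] by (auto simp: psi_eq_compl_Union)
  moreover have "continuous_map (subtopology (vietoris Z) {A. A \<noteq> {}})
      (subtopology (tau_hco X) (idempotents (tau_hco X closure_of S))) (I_ext X \<eta>)"
    using continuous_map_from_subtopology[OF cont] closure idem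
    by (auto simp: continuous_map_in_subtopology topspace_vietoris)
  moreover have "continuous_map (vietoris Z)
      (subtopology (tau_hco X) (idempotents (tau_hco X closure_of S))) (I_ext X \<eta>)"
    if "pid (topspace X) \<in> tau_hco X closure_of S"
  proof -
    have "pid (psi X \<eta> A) \<in> tau_hco X closure_of S" if "compactin Z A" for A
    proof (cases "A = {}")
      case True
      then show ?thesis using \<open>pid (topspace X) \<in> _\<close> by (simp add: psi_def)
    qed (use closure that in blast)
    then show ?thesis
      using cont idem by (auto simp: continuous_map_in_subtopology topspace_vietoris)
  qed
  moreover have "I_ext X \<eta> {z} = \<eta> z" if "z \<in> topspace Z" for z
  proof -
    have "\<eta> z \<in> partial_homeos X" "\<eta> z \<circ>\<^sub>m \<eta> z = \<eta> z"
      using \<eta>(2)[OF that] assms(3) by (auto simp: idempotents_def inverse_subsemigroup_def)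
    then show ?thesis
      using idempotent_eq_pid[of "\<eta> z" X] dom_subset_topspace[of "\<eta> z" X]
      by (simp add: I_ext_def psi_def inf_absorb2)
  qed
  ultimately show ?thesis using closure by blast
qed

end
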